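(* For every integer $k\ge 1$, there are only finitely many (up to isomorphism) $k$-vertex-critical (gem, co-gem)-free graphs.
   Context: All graphs are finite and simple. $\chi(G)$ is the chromatic number of $G$; $G$ is $k$-vertex-critical if $\chi(G)=k$ and $\chi(G-v)<k$ for every $v\in V(G)$. The co-gem is $P_4+P_1$, the disjoint union of an induced path on four vertices and a single vertex; the gem is its complement $\overline{P_4+P_1}$ (a $P_4$ together with a vertex adjacent to all four of its vertices). A graph is (gem, co-gem)-free if it contains neither the gem nor the co-gem as an induced subgraph. *)

theory Defs
  imports "Graph_Theory.Graph_Theory"
begin

text \<open>
  Finite simple graphs are represented by the locale \<^locale>\<open>pair_graph\<close>: finite, loop-free,
  symmetric digraphs without parallel arcs, where an undirected edge between u and v stands for
  the two arcs (u, v) and (v, u).  The function \<^const>\<open>with_proj\<close> embeds them into the general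
  digraphs on which \<^const>\<open>induced_subgraph\<close>, \<^const>\<open>digraph_iso\<close> and
  \<^const>\<open>pre_digraph.del_vert\<close> are defined.
\<close>

definition proper_colouring :: "('a, 'b) pre_digraph \<Rightarrow> nat \<Rightarrow> ('a \<Rightarrow> nat) \<Rightarrow> bool" where
  "proper_colouring G k c \<longleftrightarrow>
     (\<forall>v \<in> verts G. c v < k) \<and> (\<forall>(u, v) \<in> arcs_ends G. c u \<noteq> c v)"

definition chromatic_number :: "('a, 'b) pre_digraph \<Rightarrow> nat" where
  "chromatic_number G = (LEAST k. \<exists>c. proper_colouring G k c)"

definition vertex_critical :: "nat \<Rightarrow> ('a, 'b) pre_digraph \<Rightarrow> bool" where
  "vertex_critical k G \<longleftrightarrow>
     chromatic_number G = k \<and>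
     (\<forall>v \<in> verts G. chromatic_number (pre_digraph.del_vert G v) < k)"

definition path_graph :: "nat \<Rightarrow> nat pair_pre_digraph" where
  "path_graph n =
     \<lparr>pverts = {..<n}, parcs = {(i, j). i < n \<and> j < n \<and> (j = Suc i \<or> i = Suc j)}\<rparr>"

definition disjoint_union ::
  "'a pair_pre_digraph \<Rightarrow> 'b pair_pre_digraph \<Rightarrow> ('a + 'b) pair_pre_digraph" where
  "disjoint_union G H =
     \<lparr>pverts = pverts G <+> pverts H,
      parcs = map_prod Inl Inl ` parcs G \<union> map_prod Inr Inr ` parcs H\<rparr>"

definition complement_graph :: "'a pair_pre_digraph \<Rightarrow> 'a pair_pre_digraph" where
  "complement_graph G =
     \<lparr>pverts = pverts G,
      parcs = {(u, v). u \<in> pverts G \<and> v \<in> pverts G \<and> u \<noteq> v \<and> (u, v) \<notin> parcs G}\<rparr>"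

definition co_gem :: "(nat + nat) pair_pre_digraph" where
  "co_gem = disjoint_union (path_graph 4) (path_graph 1)"

definition gem :: "(nat + nat) pair_pre_digraph" where
  "gem = complement_graph co_gem"

definition contains_induced :: "('a, 'b) pre_digraph \<Rightarrow> ('c, 'd) pre_digraph \<Rightarrow> bool" where
  "contains_induced G H \<longleftrightarrow> (\<exists>S. induced_subgraph S G \<and> digraph_iso S H)"

definition gem_co_gem_free :: "('a, 'b) pre_digraph \<Rightarrow> bool" where
  "gem_co_gem_free G \<longleftrightarrow>
     \<not> contains_induced G (with_proj gem) \<and> \<not> contains_induced G (with_proj co_gem)"

end

theory Submission
  imports Defs
begin

text \<open>
  It suffices to bound the number of vertices of a k-vertex-critical co-gem-free graph G.

  A k-colouring yields a large independent set S. For y outside S put S(y) = N(y) \<inter> S. If S(y) and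
  S(z) cross, i.e. all four of S(y) \<inter> S(z), S(y) - S(z), S(z) - S(y), S - (S(y) \<union> S(z)) are
  nonempty, then y, z and suitable elements of S induce a co-gem, whether or not y and z are
  adjacent. For the same reason y and z are adjacent if S(y) is strictly contained in S(z) and both
  are nonempty and proper, so a chain of such sets comes from a clique and has at most k members.
  A family without crossing pairs is tree-like; as chains are short and S is large, some node of the
  tree branches widely. Choosing one element from each branch gives a large set U such that every
  vertex is adjacent to none, one, all but one, or all elements of U.

  Now grow disjoint, pairwise anticomplete connected sets A(u), one around each u in U, as long as
  possible. Using that G is co-gem-free, every remaining vertex is either anticomplete to all A(u) or
  complete to all but at most one of them. Delete the A(u) of smallest chromatic number and colour
  the rest with k - 1 colours; if there are enough sets, A(u) can be recoloured with the colours of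
  one of the others, so G is (k - 1)-colourable, a contradiction.
\<close>

section \<open>Families of sets without crossing pairs\<close>

text \<open>Elements are picked greedily. By laminarity the members of \<open>F\<close> through a
  point have a largest one, which fills at most a fraction 1/m of \<open>A\<close>; fewer than
  \<open>m\<close> picked points block fewer than |A| elements, and any unblocked element can be
  added.\<close>

lemma laminar_transversal:
  assumes fin: "finite A" and sub: "\<And>B. B \<in> F \<Longrightarrow> B \<subseteq> A"
    and laminar: "\<And>B C. B \<in> F \<Longrightarrow> C \<in> F \<Longrightarrow> B \<subseteq> C \<or> C \<subseteq> B \<or> B \<inter> C = {}"
    and small: "\<And>B. B \<in> F \<Longrightarrow> card B * m \<le> card A" and "m \<le> card A"
  shows "\<exists>U \<subseteq> A. card U = m \<and> (\<forall>B \<in> F. card (U \<inter> B) \<le> 1)"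
proof -
  have "finite F" using fin sub by (meson Pow_iff finite_Pow_iff finite_subset subsetI)
  \<comment> \<open>\<open>M u\<close> is the set blocked by \<open>u\<close>: the largest member
    through \<open>u\<close>, or just {u} if no member contains it. In the latter case the size
    bound comes from \<open>m \<le> card A\<close>.\<close>
  define M where "M u = insert u (\<Union>{B \<in> F. u \<in> B})" for u
  have M: "M u \<subseteq> A \<and> card (M u) * m \<le> card A" if "u \<in> A" for u
  proof (cases "{B \<in> F. u \<in> B} = {}")
    case True
    then have "M u = {u}" unfolding M_def by auto
    then show ?thesis using that assms(5) by auto
  next
    case False
    then obtain B where B: "B \<in> {B \<in> F. u \<in> B}"
        "\<And>C. C \<in> {B \<in> F. u \<in> B} \<Longrightarrow> B \<subseteq> C \<Longrightarrow> B = C"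
      using \<open>finite F\<close> finite_has_maximal[of "{B \<in> F. u \<in> B}"] by auto
    have "C \<subseteq> B" if "C \<in> F" "u \<in> C" for C
      using laminar[of B C] B that by blast
    then have "M u = B" unfolding M_def using B by auto
    then show ?thesis using B sub small by auto
  qed
  have "\<exists>U \<subseteq> A. card U = j \<and> (\<forall>B \<in> F. card (U \<inter> B) \<le> 1)" if "j \<le> m" for j
    using that
  proof (induction j)
    case 0
    then show ?case by (intro exI[of _ "{}"]) auto
  next
    case (Suc j)
    then obtain U where U: "U \<subseteq> A" "card U = j" "\<forall>B \<in> F. card (U \<inter> B) \<le> 1" by auto
    have "finite U" using U fin finite_subset by blast
    have "card (\<Union>u\<in>U. M u) * m \<le> (\<Sum>u\<in>U. card (M u)) * m"
      by (simp add: card_UN_le \<open>finite U\<close>)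
    also have "\<dots> \<le> (\<Sum>u\<in>U. card A)"
      unfolding sum_distrib_right using M U(1) by (intro sum_mono) auto
    also have "\<dots> < m * card A" using U Suc.prems assms(5) by auto
    finally have "card (\<Union>u\<in>U. M u) < card A" by (simp add: mult.commute)
    then obtain x where x: "x \<in> A" "x \<notin> (\<Union>u\<in>U. M u)"
      by (metis UN_least M U(1) card_mono fin linorder_not_less subset_iff
          finite_UN_I finite_subset \<open>finite U\<close> subsetI)
    have "x \<notin> U" using x(2) unfolding M_def by auto
    have "card (insert x U \<inter> B) \<le> 1" if "B \<in> F" for B
    proof (cases "x \<in> B")
      case True
      then have "insert x U \<inter> B = {x}" using x(2) that unfolding M_def by auto
      then show ?thesis by simp
    next
      case False
      then show ?thesis using U that by auto
    qed
    then show ?case using U x \<open>x \<notin> U\<close> \<open>finite U\<close>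
      by (intro exI[of _ "insert x U"]) auto
  qed
  then show ?thesis by blast
qed

section \<open>Splits of a set: crossing and nested pairs\<close>

definition crossing :: "'a set \<Rightarrow> 'a set \<Rightarrow> 'a set \<Rightarrow> bool" where
  "crossing S X Y \<longleftrightarrow> X \<inter> Y \<noteq> {} \<and> X - Y \<noteq> {} \<and> Y - X \<noteq> {} \<and> S - (X \<union> Y) \<noteq> {}"

text \<open>Each member of \<open>F\<close> is treated as a split of \<open>S\<close> into two
  classes, and both are recorded. In the tree picture a split is an edge, and its sides are the sets
  of elements at either end of it.\<close>

definition sides :: "'a set \<Rightarrow> 'a set set \<Rightarrow> 'a set set" where
  "sides S F = F \<union> (\<lambda>X. S - X) ` F"

lemma sides_subset: "(\<And>X. X \<in> F \<Longrightarrow> X \<subseteq> S) \<Longrightarrow> A \<in> sides S F \<Longrightarrow> A \<subseteq> S"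
  unfolding sides_def by auto

text \<open>For subsets of \<open>S\<close> the four regions in \<open>crossing\<close> play
  symmetric roles: replacing a set by its complement in \<open>S\<close> only permutes them.\<close>

lemma non_crossing_sides:
  assumes "\<And>X. X \<in> F \<Longrightarrow> X \<subseteq> S"
    and "\<And>X Y. X \<in> F \<Longrightarrow> Y \<in> F \<Longrightarrow> \<not> crossing S X Y"
    and "A \<in> sides S F" "B \<in> sides S F"
  shows "\<not> crossing S A B"
proof -
  obtain X Y where "X \<in> F" "Y \<in> F" "A = X \<or> A = S - X" "B = Y \<or> B = S - Y"
    using assms(3,4) unfolding sides_def by auto
  then show ?thesis
    using assms(1)[of X] assms(1)[of Y] assms(2)[of X Y] unfolding crossing_def
    by auto
qed

text \<open>
  The set A is found by descending from S to ever smaller sides, each time losing at most the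
  factor m, until every side strictly inside A has size below |A| / m.
\<close>

lemma minimal_side:
  assumes "finite S" and F: "\<And>X. X \<in> F \<Longrightarrow> X \<subseteq> S" and "m > 0"
    and chains: "\<And>C. C \<subseteq> F \<Longrightarrow> {} \<notin> C \<Longrightarrow> S \<notin> C \<Longrightarrow>
      (\<forall>X\<in>C. \<forall>Y\<in>C. X \<subseteq> Y \<or> Y \<subseteq> X) \<Longrightarrow> card C \<le> d"
    and large: "card S \<ge> m ^ (2 * d + 2)"
  shows "\<exists>A. (A = S \<or> A \<in> sides S F) \<and> m \<le> card A \<and>
    (\<forall>B \<in> sides S F. B \<subset> A \<longrightarrow> card B * m < card A)"
proof (rule ccontr)
  assume "\<not> ?thesis"
  \<comment> \<open>If no \<open>A\<close> qualified, every candidate with at least \<open>m\<close>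
    elements would have a side strictly inside it that keeps at least a fraction 1/m of it;
    \<open>f\<close> selects such a side.\<close>
  then have "\<exists>B. (A = S \<or> A \<in> sides S F) \<and> m \<le> card A \<longrightarrow>
      B \<in> sides S F \<and> B \<subset> A \<and> card A \<le> card B * m" for A
    by (meson linorder_not_less)
  then obtain f where f: "\<And>A. A = S \<or> A \<in> sides S F \<Longrightarrow> m \<le> card A \<Longrightarrow>
      f A \<in> sides S F \<and> f A \<subset> A \<and> card A \<le> card (f A) * m"
    by metis
  define g where "g j = (f ^^ j) S" for j
  have g_Suc: "g (Suc j) = f (g j)" for j by (simp add: g_def)
  \<comment> \<open>The exponent 2d + 2 leaves a spare factor \<open>m\<close> after up to 2d + 1
    steps, so every set of the descent still has at least \<open>m\<close> elements.\<close>
  have big: "m \<le> card X" if "card S \<le> card X * m ^ j" "j \<le> 2 * d + 1" for X j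
  proof -
    have "m * m ^ j \<le> m ^ (2 * d + 2)"
      using that(2) \<open>m > 0\<close> by (metis One_nat_def Suc_le_mono add_Suc_right
        numeral_2_eq_2 power_Suc power_increasing Suc_leI add_0_right)
    then have "m * m ^ j \<le> card X * m ^ j" using large that(1) by linarith
    then show ?thesis using \<open>m > 0\<close> by simp
  qed
  have g: "(g j = S \<or> g j \<in> sides S F) \<and> card S \<le> card (g j) * m ^ j"
    if "j \<le> 2 * d + 1" for j
    using that
  proof (induction j)
    case 0
    then show ?case by (simp add: g_def)
  next
    case (Suc j)
    then have IH: "g j = S \<or> g j \<in> sides S F" "card S \<le> card (g j) * m ^ j" by auto
    then have fg: "f (g j) \<in> sides S F" "card (g j) \<le> card (f (g j)) * m"
      using f[of "g j"] big[of "g j" j] Suc.prems by auto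
    have "card S \<le> card (f (g j)) * m * m ^ j"
      using IH(2) fg(2) by (meson le_trans mult_le_mono1)
    then show ?case using fg g_Suc by (simp add: mult.assoc)
  qed
  have dec: "g (Suc j) \<subset> g j \<and> g (Suc j) \<in> sides S F" if "j \<le> 2 * d" for j
    using f[of "g j"] g[of j] big[of "g j" j] that g_Suc by auto
  have less: "g j \<subset> g i" if "i < j" "j \<le> 2 * d + 1" for i j
    using that
  proof (induction j)
    case (Suc j)
    then show ?case using dec[of j] by (cases "i = j") auto
  qed simp
  \<comment> \<open>Index 0 is left out because \<open>g 0\<close> is \<open>S\<close>, which the
    chains must avoid. The other 2d + 1 sets are distinct, nonempty and proper.\<close>
  define J where "J = {1..2 * d + 1}"
  have inj: "inj_on g J"
    unfolding J_def by (rule inj_onI) (metis atLeastAtMost_iff less less_irrefl linorder_neqE_nat)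
  have mem: "g j \<in> sides S F \<and> g j \<noteq> {} \<and> g j \<subset> S" if "j \<in> J" for j
  proof -
    have "g j \<subset> g 0" using that less[of 0 j] unfolding J_def by auto
    moreover have "g j \<in> sides S F"
      using that dec[of "j - 1"] unfolding J_def by auto
    moreover have "m \<le> card (g j)" using g[of j] big[of "g j" j] that unfolding J_def by auto
    ultimately show ?thesis using \<open>m > 0\<close> by (auto simp: g_def)
  qed
  have comparable: "g i \<subseteq> g j \<or> g j \<subseteq> g i" if "i \<in> J" "j \<in> J" for i j
    using that less[of i j] less[of j i] unfolding J_def by (cases i j rule: linorder_cases) auto
  \<comment> \<open>A descending sequence of sides consists of members of \<open>F\<close> and
    complements of members. Either kind yields a chain in \<open>F\<close>, complementation
    reversing the order, so there can be at most 2d sides, one fewer than were produced.\<close>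
  define C1 where "C1 = g ` J \<inter> F"
  define C2 where "C2 = (\<lambda>X. S - X) ` (g ` J) \<inter> F"
  have "card C1 \<le> d"
  proof (rule chains)
    show "\<forall>X\<in>C1. \<forall>Y\<in>C1. X \<subseteq> Y \<or> Y \<subseteq> X"
      unfolding C1_def by (metis IntE comparable imageE)
    show "{} \<notin> C1" "S \<notin> C1" unfolding C1_def by (metis IntE imageE mem psubsetE)+
  qed (simp add: C1_def)
  moreover have "card C2 \<le> d"
  proof (rule chains)
    have C2: "\<exists>j \<in> J. X = S - g j" if "X \<in> C2" for X using that unfolding C2_def by auto
    show "\<forall>X\<in>C2. \<forall>Y\<in>C2. X \<subseteq> Y \<or> Y \<subseteq> X"
      by (metis C2 Diff_mono comparable order_refl)
    have "S - g j \<noteq> {} \<and> S - g j \<noteq> S" if "j \<in> J" for j using mem[OF that] by auto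
    then show "{} \<notin> C2" "S \<notin> C2" by (metis C2)+
  qed (simp add: C2_def)
  moreover have "g ` J \<subseteq> C1 \<union> (\<lambda>X. S - X) ` C2"
  proof
    fix X assume X: "X \<in> g ` J"
    then have "X \<in> sides S F" "X \<subseteq> S" using mem by auto
    then consider "X \<in> F" | "S - X \<in> F" "X = S - (S - X)"
      using F unfolding sides_def by (auto simp: double_diff)
    then show "X \<in> C1 \<union> (\<lambda>X. S - X) ` C2"
      using X unfolding C1_def C2_def by cases auto
  qed
  moreover have "finite C1" "finite C2" unfolding C1_def C2_def J_def by auto
  ultimately have "card (g ` J) \<le> d + d"
    by (meson add_mono card_Un_le card_image_le card_mono finite_UnI finite_imageI le_trans order_refl)
  moreover have "card (g ` J) = 2 * d + 1" using card_image[OF inj] by (simp add: J_def)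
  ultimately show False by simp
qed

text \<open>\<open>U\<close> is a transversal of the sides strictly inside the set \<open>A\<close>
  of \<open>minimal_side\<close>. Relative to \<open>A\<close>, a member X is disjoint from it,
  contains it, or has X or S - X strictly inside it; in each case one class of the split holds at
  most one element of \<open>U\<close>.\<close>

lemma almost_homogeneous_subset:
  assumes fin: "finite S" and F: "\<And>X. X \<in> F \<Longrightarrow> X \<subseteq> S" and "m \<ge> 2"
    and nc: "\<And>X Y. X \<in> F \<Longrightarrow> Y \<in> F \<Longrightarrow> \<not> crossing S X Y"
    and chains: "\<And>C. C \<subseteq> F \<Longrightarrow> {} \<notin> C \<Longrightarrow> S \<notin> C \<Longrightarrow>
      (\<forall>X\<in>C. \<forall>Y\<in>C. X \<subseteq> Y \<or> Y \<subseteq> X) \<Longrightarrow> card C \<le> d"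
    and large: "card S \<ge> m ^ (2 * d + 2)"
  obtains U where "U \<subseteq> S" "card U = m" "\<forall>X \<in> F. card (U \<inter> X) \<le> 1 \<or> card (U - X) \<le> 1"
proof -
  obtain A where A: "A = S \<or> A \<in> sides S F" "m \<le> card A"
      "\<And>B. B \<in> sides S F \<Longrightarrow> B \<subset> A \<Longrightarrow> card B * m < card A"
  proof -
    have "\<exists>A. (A = S \<or> A \<in> sides S F) \<and> m \<le> card A \<and>
        (\<forall>B \<in> sides S F. B \<subset> A \<longrightarrow> card B * m < card A)"
    proof (rule minimal_side)
      show "m > 0" using \<open>m \<ge> 2\<close> by simp
    qed (fact fin F chains large)+
    then show thesis using that by metis
  qed
  have "A \<subseteq> S" using A(1) sides_subset[of F S A] F by auto
  then have "finite A" using fin finite_subset by blast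
  have ncs: "\<not> crossing S X Y" if "X \<in> sides S F" "Y \<in> sides S F" for X Y
    using F nc that by (rule non_crossing_sides)
  define G where "G = {B \<in> sides S F. B \<subset> A}"
  have "\<exists>U \<subseteq> A. card U = m \<and> (\<forall>B \<in> G. card (U \<inter> B) \<le> 1)"
  proof (rule laminar_transversal)
    fix B C assume BC: "B \<in> G" "C \<in> G"
    \<comment> \<open>As \<open>m \<ge> 2\<close>, a side strictly inside \<open>A\<close> has less
      than half of its elements, so two of them cannot cover \<open>A\<close>. The fourth region is
      then nonempty, and non-crossing means laminar.\<close>
    then have "card B * 2 < card A" "card C * 2 < card A"
      using A(3)[of B] A(3)[of C] \<open>m \<ge> 2\<close> unfolding G_def
      by (auto intro: le_less_trans[OF mult_le_mono2])
    then have "card (B \<union> C) < card A"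
      using card_Un_le[of B C] by linarith
    then have "A - (B \<union> C) \<noteq> {}"
      using BC \<open>finite A\<close> unfolding G_def
      by (metis Diff_eq_empty_iff card_mono finite_Un finite_subset linorder_not_less mem_Collect_eq psubsetE)
    then show "B \<subseteq> C \<or> C \<subseteq> B \<or> B \<inter> C = {}"
      using ncs[of B C] BC \<open>A \<subseteq> S\<close> unfolding G_def crossing_def by blast
  qed (use A \<open>finite A\<close> in \<open>auto simp: G_def intro: less_imp_le\<close>)
  then obtain U where U: "U \<subseteq> A" "card U = m" "\<forall>B \<in> G. card (U \<inter> B) \<le> 1" by blast
  have "card (U \<inter> X) \<le> 1 \<or> card (U - X) \<le> 1" if XF: "X \<in> F" for X
  proof -
    have X: "X \<in> sides S F" "S - X \<in> sides S F" using XF unfolding sides_def by auto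
    have UX: "U - X = U \<inter> (S - X)" using U(1) \<open>A \<subseteq> S\<close> by auto
    \<comment> \<open>\<open>A = S\<close> is treated apart since \<open>S\<close> need not be a
      side; otherwise each of the four empty regions gives one alternative.\<close>
    have "A \<inter> X = {} \<or> A \<subseteq> X \<or> X \<subset> A \<or> S - X \<subset> A"
    proof (cases "A = S")
      case True
      then show ?thesis using F[OF XF] by (metis psubsetI order_refl)
    next
      case False
      then have "A \<in> sides S F" using A by simp
      then have "\<not> crossing S A X" using ncs X by blast
      then show ?thesis
        unfolding crossing_def using \<open>A \<subseteq> S\<close> F[OF XF] by blast
    qed
    then consider "A \<inter> X = {}" | "A \<subseteq> X" | "X \<subset> A" | "S - X \<subset> A" by blast
    then show ?thesis
    proof cases
      case 1
      then have "U \<inter> X = {}" using U by auto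
      then show ?thesis by simp
    next
      case 2
      then have "U - X = {}" using U by auto
      then have "card (U - X) = 0" by (simp only: card.empty)
      then show ?thesis by simp
    next
      case 3
      then show ?thesis using U X unfolding G_def by auto
    next
      case 4
      then show ?thesis using U X unfolding G_def UX by auto
    qed
  qed
  then show ?thesis using that U \<open>A \<subseteq> S\<close> by blast
qed

section \<open>Colourings and criticality\<close>

text \<open>An adjacency relation is kept fixed while the vertex set varies, so induced subgraphs
  are plain subsets and need not be constructed.\<close>

definition colourable :: "('a \<Rightarrow> 'a \<Rightarrow> bool) \<Rightarrow> 'a set \<Rightarrow> nat \<Rightarrow> bool" where
  "colourable adj W n \<longleftrightarrow>
     (\<exists>c::'a \<Rightarrow> nat. c ` W \<subseteq> {..<n} \<and> (\<forall>u\<in>W. \<forall>v\<in>W. adj u v \<longrightarrow> c u \<noteq> c v))"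

definition chi :: "('a \<Rightarrow> 'a \<Rightarrow> bool) \<Rightarrow> 'a set \<Rightarrow> nat" where
  "chi adj W = (LEAST n. colourable adj W n)"

lemma colourable_mono:
  "colourable adj W n \<Longrightarrow> n \<le> n' \<Longrightarrow> W' \<subseteq> W \<Longrightarrow> colourable adj W' n'"
  unfolding colourable_def by (meson image_mono lessThan_subset_iff order_trans subsetD)

text \<open>Only the number of colours matters. This lets one set be recoloured with exactly the
  colours that appear on another.\<close>

lemma colourable_iff_colours:
  fixes C :: "'c set"
  assumes "finite C"
  shows "colourable adj W (card C) \<longleftrightarrow>
    (\<exists>c::'a \<Rightarrow> 'c. c ` W \<subseteq> C \<and> (\<forall>u\<in>W. \<forall>v\<in>W. adj u v \<longrightarrow> c u \<noteq> c v))"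
proof
  obtain h where h: "bij_betw h {..<card C} C"
    using assms ex_bij_betw_nat_finite atLeast0LessThan by metis
  assume "colourable adj W (card C)"
  then obtain c :: "'a \<Rightarrow> nat" where c: "c ` W \<subseteq> {..<card C}"
      "\<forall>u\<in>W. \<forall>v\<in>W. adj u v \<longrightarrow> c u \<noteq> c v"
    unfolding colourable_def by blast
  have "(h \<circ> c) ` W \<subseteq> C" using c(1) h unfolding bij_betw_def by (metis image_comp image_mono)
  moreover have "(h \<circ> c) u \<noteq> (h \<circ> c) v" if "u \<in> W" "v \<in> W" "adj u v" for u v
  proof -
    have "c u \<in> {..<card C}" "c v \<in> {..<card C}" "c u \<noteq> c v" using that c by auto
    then show ?thesis using h unfolding bij_betw_def inj_on_def by auto
  qed
  ultimately show "\<exists>c::'a \<Rightarrow> 'c. c ` W \<subseteq> C \<and> (\<forall>u\<in>W. \<forall>v\<in>W. adj u v \<longrightarrow> c u \<noteq> c v)"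
    by (intro exI[of _ "h \<circ> c"]) blast
next
  obtain h where h: "bij_betw h C {..<card C}"
    using assms ex_bij_betw_finite_nat atLeast0LessThan by metis
  assume "\<exists>c::'a \<Rightarrow> 'c. c ` W \<subseteq> C \<and> (\<forall>u\<in>W. \<forall>v\<in>W. adj u v \<longrightarrow> c u \<noteq> c v)"
  then obtain c where c: "c ` W \<subseteq> C" "\<forall>u\<in>W. \<forall>v\<in>W. adj u v \<longrightarrow> c u \<noteq> c v" by blast
  have "(h \<circ> c) ` W \<subseteq> {..<card C}"
    using c(1) h unfolding bij_betw_def by (metis image_comp image_mono)
  moreover have "(h \<circ> c) u \<noteq> (h \<circ> c) v" if "u \<in> W" "v \<in> W" "adj u v" for u v
  proof -
    have "c u \<in> C" "c v \<in> C" "c u \<noteq> c v" using that c by auto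
    then show ?thesis using h unfolding bij_betw_def inj_on_def by auto
  qed
  ultimately show "colourable adj W (card C)"
    unfolding colourable_def by (intro exI[of _ "h \<circ> c"]) blast
qed

section \<open>Recolouring in finite simple graphs\<close>

locale simple_graph =
  fixes V :: "'a set" and adj :: "'a \<Rightarrow> 'a \<Rightarrow> bool"
  assumes finite_V: "finite V"
    and adj_sym: "adj x y \<Longrightarrow> adj y x"
    and adj_irrefl: "\<not> adj x x"
begin

lemma colourable_card: "W \<subseteq> V \<Longrightarrow> colourable adj W (card W)"
  using colourable_iff_colours[of W adj W] finite_V finite_subset adj_irrefl
  by (metis id_apply image_id order_refl)

lemma colourable_chi: "W \<subseteq> V \<Longrightarrow> colourable adj W (chi adj W)"
  unfolding chi_def using LeastI colourable_card by metis

text \<open>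
  Let the member of smallest chromatic number be deleted and the rest coloured with n colours. An
  index i is bad if some outside vertex that is not complete to the member A i shares a colour with
  it. That vertex is complete to all other members, so its colour occurs in no other member, and
  hence there are at most n bad indices. The deleted member can reuse the colours of a member
  with good index.
\<close>

lemma homogeneous_family_colourable:
  fixes I :: "'i set"
  assumes "finite I" and card_I: "card I \<ge> n + 2"
    and A: "\<And>i. i \<in> I \<Longrightarrow> A i \<subseteq> V" "\<And>i. i \<in> I \<Longrightarrow> A i \<noteq> {}"
    and anti: "\<And>i j x y. i \<in> I \<Longrightarrow> j \<in> I \<Longrightarrow> i \<noteq> j \<Longrightarrow> x \<in> A i \<Longrightarrow> y \<in> A j \<Longrightarrow>
      x \<noteq> y \<and> \<not> adj x y"
    and outside: "\<And>y. y \<in> V \<Longrightarrow> y \<notin> (\<Union>i\<in>I. A i) \<Longrightarrow>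
      (\<forall>i\<in>I. \<forall>x\<in>A i. \<not> adj y x) \<or> (\<exists>j\<in>I. \<forall>i\<in>I - {j}. \<forall>x\<in>A i. adj y x)"
    and crit: "\<And>v. v \<in> V \<Longrightarrow> colourable adj (V - {v}) n"
  shows "colourable adj V n"
proof -
  have "I \<noteq> {}" using card_I by auto
  then obtain i0 where "i0 \<in> I" by blast
  from ex_has_least_nat[of "\<lambda>i. i \<in> I", OF this, of "\<lambda>i. chi adj (A i)"]
  obtain z where z: "z \<in> I" "\<And>i. i \<in> I \<Longrightarrow> chi adj (A z) \<le> chi adj (A i)" by metis
  obtain v where v: "v \<in> A z" using A(2) z by blast
  have "colourable adj (V - A z) n"
    by (rule colourable_mono[OF crit[of v]]) (use v A z in auto)
  then obtain c where c: "c ` (V - A z) \<subseteq> {..<n}"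
      "\<And>x y. x \<in> V - A z \<Longrightarrow> y \<in> V - A z \<Longrightarrow> adj x y \<Longrightarrow> c x \<noteq> c y"
    unfolding colourable_def by blast
  define J where "J = I - {z}"
  have Aout: "A i \<subseteq> V - A z" if "i \<in> J" for i
    using that A(1) anti[OF _ z(1)] unfolding J_def by blast
  \<comment> \<open>That \<open>y\<close> is not complete to \<open>A i\<close> follows from the
    shared colour when \<open>i \<noteq> z\<close>, as \<open>c\<close> is proper off
    \<open>A z\<close>.\<close>
  define bad where "bad i y \<longleftrightarrow> y \<in> V \<and> y \<notin> (\<Union>i\<in>I. A i) \<and> c y \<in> c ` A i \<and>
    (\<forall>j\<in>I - {i}. \<forall>x\<in>A j. adj y x)" for i y
  have "card {i \<in> J. \<exists>y. bad i y} \<le> n"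
  proof -
    define h where "h i = (SOME y. bad i y)" for i
    have h: "bad i (h i)" if "i \<in> {i \<in> J. \<exists>y. bad i y}" for i
    proof -
      from that have "\<exists>y. bad i y" by blast
      then show ?thesis unfolding h_def by (rule someI_ex)
    qed
    have hV: "h i \<in> V - A z" if "i \<in> {i \<in> J. \<exists>y. bad i y}" for i
      using h[OF that] z(1) unfolding bad_def by blast
    have "inj_on (c \<circ> h) {i \<in> J. \<exists>y. bad i y}"
    proof (rule inj_onI, rule ccontr)
      fix i j assume ij: "i \<in> {i \<in> J. \<exists>y. bad i y}" "j \<in> {i \<in> J. \<exists>y. bad i y}"
        "(c \<circ> h) i = (c \<circ> h) j" "i \<noteq> j"
      obtain x where x: "x \<in> A j" "c (h j) = c x" using h[OF ij(2)] unfolding bad_def by auto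
      then have "adj (h i) x" using h[OF ij(1)] ij unfolding bad_def J_def by auto
      moreover have "x \<in> V - A z" using x(1) Aout ij by auto
      ultimately have "c (h i) \<noteq> c x" using c(2) hV[OF ij(1)] by auto
      then show False using ij(3) x by simp
    qed
    moreover have "(c \<circ> h) ` {i \<in> J. \<exists>y. bad i y} \<subseteq> {..<n}" using hV c(1) by auto
    ultimately show ?thesis by (metis card_inj_on_le card_lessThan finite_lessThan)
  qed
  \<comment> \<open>Removing \<open>z\<close> from at least n + 2 indices leaves n + 1, more than
    can be bad.\<close>
  moreover have "card J \<ge> n + 1" using card_I z(1) \<open>finite I\<close> unfolding J_def by simp
  ultimately have "{i \<in> J. \<exists>y. bad i y} \<noteq> J" by auto
  then obtain i where i: "i \<in> J" "\<And>y. \<not> bad i y" by blast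
  then have "i \<in> I" "i \<noteq> z" unfolding J_def by auto
  have "finite (A i)" using A(1)[OF \<open>i \<in> I\<close>] finite_V finite_subset by blast
  then have fin: "finite (c ` A i)" by blast
  \<comment> \<open>The colours seen on \<open>A i\<close> number at least its chromatic number,
    hence by the choice of \<open>z\<close> they suffice for \<open>A z\<close>.\<close>
  have "colourable adj (A i) (card (c ` A i))"
    unfolding colourable_iff_colours[OF fin] using c(2) Aout[OF i(1)] by blast
  then have "chi adj (A i) \<le> card (c ` A i)" unfolding chi_def by (rule Least_le)
  then have "colourable adj (A z) (card (c ` A i))"
    using colourable_chi[OF A(1)[OF z(1)]] z(2)[OF \<open>i \<in> I\<close>] colourable_mono by (meson order_refl order_trans)
  then obtain f where f: "f ` A z \<subseteq> c ` A i" "\<And>x y. x \<in> A z \<Longrightarrow> y \<in> A z \<Longrightarrow> adj x y \<Longrightarrow> f x \<noteq> f y"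
    unfolding colourable_iff_colours[OF fin] by blast
  define c' where "c' x = (if x \<in> A z then f x else c x)" for x
  \<comment> \<open>A neighbour \<open>y\<close> of \<open>A z\<close> outside \<open>A z\<close>
    lies in no member, so it is complete to all members but some \<open>A j\<close>. If it had a
    colour reused from \<open>A i\<close>, then either i = j and \<open>y\<close> makes
    \<open>i\<close> bad, or \<open>y\<close> is adjacent to a vertex of \<open>A i\<close> of its
    own colour.\<close>
  have cross: "f x \<noteq> c y" if xy: "x \<in> A z" "y \<in> V - A z" "adj x y" for x y
  proof
    assume eq: "f x = c y"
    have "y \<notin> (\<Union>i\<in>I. A i)" using anti[OF z(1)] xy by fastforce
    moreover have "adj y x" using xy(3) adj_sym by blast
    ultimately obtain j where j: "j \<in> I" "\<forall>i\<in>I - {j}. \<forall>x\<in>A i. adj y x"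
      using outside[of y] xy z(1) by blast
    have "f x \<in> c ` A i" using f(1) imageI[OF xy(1)] by (rule subsetD)
    then have cy: "c y \<in> c ` A i" unfolding eq .
    show False
    proof (cases "i = j")
      case True
      then have "bad i y" using j(2) cy \<open>y \<notin> (\<Union>i\<in>I. A i)\<close> xy(2) unfolding bad_def by blast
      then show False using i(2) by blast
    next
      case False
      obtain w where w: "w \<in> A i" "c y = c w" using cy by auto
      then have "adj y w" using j False \<open>i \<in> I\<close> by auto
      then show False using c(2)[of y w] w xy Aout[OF i(1)] by auto
    qed
  qed
  have "c' ` V \<subseteq> {..<n}"
  proof (rule image_subsetI)
    fix x assume "x \<in> V"
    moreover have "f ` A z \<subseteq> {..<n}"
      using f(1) c(1) image_mono[OF Aout[OF i(1)], of c] by (meson order_trans)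
    ultimately show "c' x \<in> {..<n}" using c(1) unfolding c'_def by (auto simp: image_subset_iff)
  qed
  moreover have "c' x \<noteq> c' y" if "x \<in> V" "y \<in> V" "adj x y" for x y
    using that c(2)[of x y] f(2)[of x y] cross[of x y] cross[of y x] adj_sym[of x y]
    unfolding c'_def by (metis DiffI)
  ultimately show ?thesis unfolding colourable_def by blast
qed

text \<open>Connectivity is phrased through cuts rather than paths: applied to the neighbours of an
  outside vertex, it directly yields an edge from a neighbour to a non-neighbour.\<close>

definition connected_set :: "'a set \<Rightarrow> bool" where
  "connected_set W \<longleftrightarrow>
     (\<forall>B. B \<subset> W \<and> B \<noteq> {} \<longrightarrow> (\<exists>x \<in> B. \<exists>y \<in> W - B. adj x y))"

lemma connected_set_singleton: "connected_set {x}"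
  unfolding connected_set_def by auto

lemma connected_set_insert:
  assumes "connected_set W" "x \<in> W" "adj y x"
  shows "connected_set (insert y W)"
  unfolding connected_set_def
proof (intro allI impI)
  fix B assume B: "B \<subset> insert y W \<and> B \<noteq> {}"
  consider "y \<in> W" | "y \<notin> W" "B = {y}" | "y \<notin> W" "B = W" | "y \<notin> W" "B - {y} \<subset> W" "B - {y} \<noteq> {}"
    using B by blast
  then show "\<exists>a\<in>B. \<exists>b\<in>insert y W - B. adj a b"
  proof cases
    case 1
    then show ?thesis using assms(1) B unfolding connected_set_def by (simp add: insert_absorb)
  next
    case 2
    then show ?thesis using assms by auto
  next
    case 3
    then show ?thesis using assms adj_sym by auto
  next
    case 4
    then obtain a b where "a \<in> B - {y}" "b \<in> W - (B - {y})" "adj a b"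
      using assms(1) unfolding connected_set_def by blast
    then show ?thesis using 4(1) by blast
  qed
qed

end

text \<open>
  The (non-)adjacencies force the path a b c d and the isolated vertex e to be pairwise distinct.
\<close>

locale co_gem_free_graph = simple_graph +
  assumes no_co_gem: "\<lbrakk>a \<in> V; b \<in> V; c \<in> V; d \<in> V; e \<in> V; adj a b; adj b c; adj c d;
    \<not> adj a c; \<not> adj a d; \<not> adj b d; \<not> adj a e; \<not> adj b e; \<not> adj c e; \<not> adj d e\<rbrakk> \<Longrightarrow> False"
begin

text \<open>The singletons of \<open>U\<close> are grown to a maximal family as required by
  \<open>homogeneous_family_colourable\<close>. A remaining vertex that splits some member is
  complete to all others by co-gem-freeness; one that splits none is governed by its trace on
  \<open>U\<close>.\<close>

lemma almost_homogeneous_set_colourable: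
  assumes "U \<subseteq> V" and card_U: "card U \<ge> n + 2" "card U \<ge> 3"
    and indep: "\<And>u v. u \<in> U \<Longrightarrow> v \<in> U \<Longrightarrow> \<not> adj u v"
    and trace: "\<And>y. y \<in> V - U \<Longrightarrow> card {u \<in> U. adj y u} \<le> 1 \<or> card {u \<in> U. \<not> adj y u} \<le> 1"
    and crit: "\<And>v. v \<in> V \<Longrightarrow> colourable adj (V - {v}) n"
  shows "colourable adj V n"
proof -
  have "finite U" using assms(1) finite_V finite_subset by blast
  define good where "good A \<longleftrightarrow> (\<forall>u\<in>U. u \<in> A u \<and> A u \<subseteq> V \<and> connected_set (A u)) \<and>
    (\<forall>u\<in>U. \<forall>v\<in>U. u \<noteq> v \<longrightarrow> (\<forall>x\<in>A u. \<forall>y\<in>A v. x \<noteq> y \<and> \<not> adj x y))" for A :: "'a \<Rightarrow> 'a set"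
  have "good (\<lambda>u. {u})"
    unfolding good_def using assms(1) indep connected_set_singleton by auto
  \<comment> \<open>Total sizes of good families are bounded, so a good family of largest total size
    exists.\<close>
  moreover have "(\<Sum>u\<in>U. card (A u)) < Suc (card U * card V)" if "good A" for A
    using sum_bounded_above[of U "\<lambda>u. card (A u)" "card V"] that card_mono[OF finite_V]
    unfolding good_def by (simp add: less_Suc_eq_le)
  ultimately obtain A where A: "good A"
      "\<And>B. good B \<Longrightarrow> (\<Sum>u\<in>U. card (B u)) \<le> (\<Sum>u\<in>U. card (A u))"
    using ex_has_greatest_nat[of good "\<lambda>u. {u}" "\<lambda>A. \<Sum>u\<in>U. card (A u)"] by blast
  have mem: "u \<in> A u" "A u \<subseteq> V" "connected_set (A u)" if "u \<in> U" for u
    using A(1) that unfolding good_def by auto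
  have anti: "x \<noteq> y \<and> \<not> adj x y" if "u \<in> U" "v \<in> U" "u \<noteq> v" "x \<in> A u" "y \<in> A v" for u v x y
    using A(1)[unfolded good_def, THEN conjunct2] that by blast
  \<comment> \<open>Maximality: if \<open>y\<close> had neighbours in one member only, it could be
    added to that member.\<close>
  have closed: "\<exists>v \<in> U - {u}. \<exists>x \<in> A v. adj y x"
    if y: "y \<in> V" "y \<notin> (\<Union>u\<in>U. A u)" and u: "u \<in> U" "x \<in> A u" "adj y x" for y u x
  proof (rule ccontr)
    assume no: "\<not> ?thesis"
    define B where "B = A(u := insert y (A u))"
    have "connected_set (B w)" if "w \<in> U" for w
      using that mem(3) connected_set_insert[of "A u" x y] u unfolding B_def by auto
    moreover have "p \<noteq> q \<and> \<not> adj p q"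
      if "w \<in> U" "v \<in> U" "w \<noteq> v" "p \<in> B w" "q \<in> B v" for w v p q
      using that anti[of w v p q] no y(2) adj_sym[of p q] u(1)
      unfolding B_def by (auto split: if_splits)
    moreover have "w \<in> B w" "B w \<subseteq> V" if "w \<in> U" for w
      using mem(1,2)[OF that] y(1) unfolding B_def by auto
    ultimately have "good B" unfolding good_def by blast
    have "card (B u) = Suc (card (A u))"
      using y(2) u(1) mem(2)[OF u(1)] finite_V finite_subset unfolding B_def
      by (auto intro!: card_insert_disjoint)
    then have "(\<Sum>u\<in>U. card (A u)) < (\<Sum>u\<in>U. card (B u))"
      using \<open>finite U\<close> u(1)
      by (intro sum_strict_mono_ex1) (auto simp: B_def)
    then show False using A(2)[OF \<open>good B\<close>] by simp
  qed
  show ?thesis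
  proof (rule homogeneous_family_colourable[where I = U and A = A])
    fix y assume y: "y \<in> V" "y \<notin> (\<Union>u\<in>U. A u)"
    show "(\<forall>u\<in>U. \<forall>x\<in>A u. \<not> adj y x) \<or> (\<exists>j\<in>U. \<forall>i\<in>U - {j}. \<forall>x\<in>A i. adj y x)"
    proof (cases "\<exists>u\<in>U. \<exists>x\<in>A u. \<exists>x'\<in>A u. adj y x \<and> \<not> adj y x'")
      case True
      then obtain u where u: "u \<in> U" "\<exists>x\<in>A u. \<exists>x'\<in>A u. adj y x \<and> \<not> adj y x'" by blast
      then have "{x \<in> A u. adj y x} \<subset> A u \<and> {x \<in> A u. adj y x} \<noteq> {}" by auto
      from mem(3)[OF u(1), unfolded connected_set_def, rule_format, OF this]
      obtain p q where pq: "p \<in> A u" "adj y p" "q \<in> A u" "\<not> adj y q" "adj p q" by blast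
      \<comment> \<open>Here q p y x is an induced path, and a non-neighbour \<open>x'\<close> of
        \<open>y\<close> in a third member would complete a co-gem.\<close>
      have spread: "adj y x'" if "v \<in> U - {u}" "x \<in> A v" "adj y x" "w \<in> U - {u, v}" "x' \<in> A w"
        for v w x x'
      proof (rule ccontr)
        assume no: "\<not> adj y x'"
        have uvw: "v \<in> U" "w \<in> U" "u \<noteq> v" "u \<noteq> w" "v \<noteq> w" using that by auto
        have "q \<in> V" "p \<in> V" "x \<in> V" "x' \<in> V"
          using mem(2) pq u(1) uvw that by blast+
        moreover have "\<not> adj q x" "\<not> adj p x" "\<not> adj q x'" "\<not> adj p x'" "\<not> adj x x'"
          using anti u(1) uvw pq(1,3) that(2,5) by blast+
        ultimately show False
          using no_co_gem[of q p y x x'] no y(1) pq(2,4,5) that(3) adj_sym by blast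
      qed
      obtain v x where v: "v \<in> U - {u}" "x \<in> A v" "adj y x"
        using closed[OF y u(1) pq(1,2)] by blast
      have "\<not> U \<subseteq> {u, v}"
      proof
        assume "U \<subseteq> {u, v}"
        then have "card U \<le> card {u, v}" by (rule card_mono[rotated]) simp
        then show False using card_U(2) v(1) by auto
      qed
      then obtain w where w: "w \<in> U - {u, v}" by blast
      \<comment> \<open>From \<open>v\<close>, adjacency spreads to all members other than
        \<open>A u\<close> and \<open>A v\<close>. A third index \<open>w\<close> is needed to
        spread it back to the whole of \<open>A v\<close>.\<close>
      have "adj y x'" if "i \<in> U - {u}" "x' \<in> A i" for i x'
      proof (cases "i = v")
        case True
        have "adj y w" using spread[OF v w] mem(1) w by blast
        then show ?thesis using spread[of w w v x'] mem(1) w v(1) that True by blast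
      next
        case False
        then show ?thesis using spread[OF v] that by blast
      qed
      then show ?thesis using u(1) by blast
    next
      case False
      then have hom: "adj y x \<longleftrightarrow> adj y u" if "u \<in> U" "x \<in> A u" for u x
        using that mem(1) by blast
      have "y \<in> V - U" using y mem(1) by blast
      then consider "card {u \<in> U. adj y u} \<le> 1" | "card {u \<in> U. \<not> adj y u} \<le> 1"
        using trace by blast
      then show ?thesis
      proof cases
        case 1
        \<comment> \<open>A single neighbour in \<open>U\<close> is impossible:
          \<open>closed\<close> gives a neighbour in a second member, and by homogeneity a second
          neighbour in \<open>U\<close>.\<close>
        have "\<not> adj y u" if uU: "u \<in> U" for u
        proof
          assume "adj y u"
          then obtain v x where v: "v \<in> U - {u}" "x \<in> A v" "adj y x"
            using closed[OF y uU mem(1)[OF uU]] by blast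
          then have "{u, v} \<subseteq> {u \<in> U. adj y u}" using hom \<open>adj y u\<close> uU by auto
          then have "card {u, v} \<le> card {u \<in> U. adj y u}"
            using \<open>finite U\<close> by (intro card_mono) auto
          then have "card {u, v} \<le> 1" using 1 by simp
          then show False using v(1) by auto
        qed
        then show ?thesis using hom by blast
      next
        case 2
        \<comment> \<open>The exceptional index is the only non-neighbour in \<open>U\<close>; if
          there is none, any element of \<open>U\<close> serves.\<close>
        have "\<exists>j\<in>U. {u \<in> U. \<not> adj y u} \<subseteq> {j}"
        proof (cases "{u \<in> U. \<not> adj y u} = {}")
          case True
          then show ?thesis using card_U(2) by (metis all_not_in_conv card.empty empty_subsetI not_numeral_le_zero)
        next
          case False
          then obtain j where j: "j \<in> U" "\<not> adj y j" by blast
          have "finite {u \<in> U. \<not> adj y u}" using \<open>finite U\<close> by simp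
          then have "\<forall>i \<in> {u \<in> U. \<not> adj y u}. \<forall>j \<in> {u \<in> U. \<not> adj y u}. i = j"
            using 2 card_le_Suc0_iff_eq by (metis One_nat_def)
          then show ?thesis using j by blast
        qed
        then show ?thesis using hom by blast
      qed
    qed
  next
    show "A u \<noteq> {}" if "u \<in> U" for u using mem(1)[OF that] by blast
  qed (fact \<open>finite U\<close> card_U(1) mem(2) anti crit)+
qed

text \<open>In a larger graph some colour class \<open>S\<close> has at least (k + 2)^(2k + 2)
  vertices, enough for \<open>almost_homogeneous_subset\<close> with m = k + 2 and d = k. The
  resulting k + 2 vertices meet both size demands of the recolouring lemma for n = k - 1, also when
  k = 1.\<close>

lemma card_le_of_critical:
  assumes "colourable adj V k" "\<not> colourable adj V (k - 1)"
    and crit: "\<And>v. v \<in> V \<Longrightarrow> colourable adj (V - {v}) (k - 1)"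
  shows "card V \<le> k * (k + 2) ^ (2 * k + 2)"
proof (rule ccontr)
  assume big: "\<not> ?thesis"
  obtain c where c: "c ` V \<subseteq> {..<k}" "\<And>x y. x \<in> V \<Longrightarrow> y \<in> V \<Longrightarrow> adj x y \<Longrightarrow> c x \<noteq> c y"
    using assms(1) unfolding colourable_def by blast
  have "\<exists>a<k. card {x \<in> V. c x = a} \<ge> (k + 2) ^ (2 * k + 2)"
  proof (rule ccontr)
    assume small: "\<not> ?thesis"
    have "card V = card (\<Union>a\<in>{..<k}. {x \<in> V. c x = a})"
      using c(1) by (intro arg_cong[of _ _ card]) auto
    also have "\<dots> \<le> (\<Sum>a<k. card {x \<in> V. c x = a})" by (rule card_UN_le) simp
    also have "\<dots> \<le> (\<Sum>a<k. (k + 2) ^ (2 * k + 2))"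
      using small by (intro sum_mono) (auto simp: not_le less_imp_le)
    finally show False using big by simp
  qed
  then obtain a where "card {x \<in> V. c x = a} \<ge> (k + 2) ^ (2 * k + 2)" by blast
  define S where "S = {x \<in> V. c x = a}"
  have "S \<subseteq> V" "finite S" unfolding S_def using finite_V by auto
  have indep: "\<not> adj x y" if "x \<in> S" "y \<in> S" for x y
    using that c(2) unfolding S_def by force
  define N where "N y = {u \<in> S. adj y u}" for y
  obtain U where U: "U \<subseteq> S" "card U = k + 2"
      "\<forall>X \<in> N ` (V - S). card (U \<inter> X) \<le> 1 \<or> card (U - X) \<le> 1"
  proof (rule almost_homogeneous_subset[of S "N ` (V - S)" "k + 2" k])
    fix X Y assume "X \<in> N ` (V - S)" "Y \<in> N ` (V - S)"
    then obtain y z where yz: "y \<in> V" "z \<in> V" "X = N y" "Y = N z" by blast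
    show "\<not> crossing S X Y"
    proof
      assume "crossing S X Y"
      then obtain u w u' t where w: "u \<in> N y - N z" "w \<in> N y \<inter> N z" "u' \<in> N z - N y" "t \<in> S - (N y \<union> N z)"
        unfolding crossing_def yz by blast
      then have V: "u \<in> V" "w \<in> V" "u' \<in> V" "t \<in> V" using \<open>S \<subseteq> V\<close> unfolding N_def by auto
      have S: "u \<in> S" "w \<in> S" "u' \<in> S" "t \<in> S" using w unfolding N_def by auto
      have a: "adj y u" "\<not> adj z u" "adj y w" "adj z w" "adj z u'" "\<not> adj y u'" "\<not> adj y t" "\<not> adj z t"
        using w unfolding N_def by auto
      show False
      \<comment> \<open>The co-gem is the path u y z u' if \<open>y\<close> and \<open>z\<close> are
        adjacent, and the path u y w z otherwise; \<open>t\<close> is isolated in both.\<close>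
      proof (cases "adj y z")
        case True
        then show False
          using no_co_gem[OF V(1) yz(1,2) V(3,4)] a True adj_sym indep S by blast
      next
        case False
        then show False
          using no_co_gem[OF V(1) yz(1) V(2) yz(2) V(4)] a False adj_sym indep S by blast
      qed
    qed
  next
    fix C assume C: "C \<subseteq> N ` (V - S)" "{} \<notin> C" "S \<notin> C" "\<forall>X\<in>C. \<forall>Y\<in>C. X \<subseteq> Y \<or> Y \<subseteq> X"
    have "\<forall>X \<in> C. \<exists>y. y \<in> V - S \<and> X = N y" using C(1) by blast
    then obtain r where "\<forall>X \<in> C. r X \<in> V - S \<and> X = N (r X)"
      by (rule bchoice[THEN exE])
    then have r: "r X \<in> V - S" "X = N (r X)" if "X \<in> C" for X using that by auto
    \<comment> \<open>Without this edge, u, \<open>r Y\<close>, w, \<open>r X\<close> would be an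
      induced path with \<open>t\<close> isolated from it.\<close>
    have nested: "adj (r X) (r Y)" if XY: "X \<in> C" "Y \<in> C" "X \<subset> Y" for X Y
    proof (rule ccontr)
      assume no: "\<not> adj (r X) (r Y)"
      have ne: "X \<noteq> {}" "Y \<noteq> S" "Y \<subseteq> S" using C XY r(2)[of Y] unfolding N_def by blast+
      then obtain u w t where w: "u \<in> Y - X" "w \<in> X" "t \<in> S - Y" using XY(3) by blast
      have S: "u \<in> S" "w \<in> S" "t \<in> S" using w ne XY by auto
      have "adj (r Y) u" "\<not> adj (r X) u" "adj (r X) w" "adj (r Y) w" "\<not> adj (r X) t" "\<not> adj (r Y) t"
        using w XY r(2)[of X] r(2)[of Y] S unfolding N_def by blast+
      moreover have "u \<in> V" "w \<in> V" "t \<in> V" "r X \<in> V" "r Y \<in> V"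
        using S \<open>S \<subseteq> V\<close> r(1) XY by blast+
      ultimately show False
        using no_co_gem[of u "r Y" w "r X" t] no S adj_sym indep by blast
    qed
    \<comment> \<open>The representatives of a chain are pairwise adjacent, so they receive distinct
      ones of the \<open>k\<close> colours.\<close>
    have "inj_on (c \<circ> r) C"
    proof (rule inj_onI, rule ccontr)
      fix X Y assume XY: "X \<in> C" "Y \<in> C" "(c \<circ> r) X = (c \<circ> r) Y" "X \<noteq> Y"
      then have "adj (r X) (r Y)" using nested[of X Y] nested[of Y X] C(4) adj_sym by blast
      then show False using c(2)[of "r X" "r Y"] r(1) XY by auto
    qed
    moreover have "(c \<circ> r) ` C \<subseteq> {..<k}" using r(1) c(1) by auto
    ultimately show "card C \<le> k" by (metis card_inj_on_le card_lessThan finite_lessThan)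
  qed (use \<open>finite S\<close> \<open>card {x \<in> V. c x = a} \<ge> _\<close> in \<open>auto simp: N_def S_def\<close>)
  have "colourable adj V (k - 1)"
  proof (rule almost_homogeneous_set_colourable[of U])
    fix y assume y: "y \<in> V - U"
    show "card {u \<in> U. adj y u} \<le> 1 \<or> card {u \<in> U. \<not> adj y u} \<le> 1"
    proof (cases "y \<in> S")
      case True
      then have "{u \<in> U. adj y u} = {}" using indep U(1) by blast
      then show ?thesis by (metis card.empty zero_le)
    next
      case False
      have "U \<inter> N y = {u \<in> U. adj y u}" "U - N y = {u \<in> U. \<not> adj y u}"
        using U(1) unfolding N_def by auto
      then show ?thesis using U(3) y False by (metis DiffE DiffI image_eqI)
    qed
  next
    \<comment> \<open>For k = 0 truncated subtraction gives k - 1 = k, and the two colourability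
      assumptions would contradict each other.\<close>
    have "k \<noteq> 0" using assms(1,2) by (intro notI) simp
    then show "3 \<le> card U" using U by simp
  next
    show "\<not> adj u v" if "u \<in> U" "v \<in> U" for u v using indep U(1) that by blast
  qed (use U \<open>S \<subseteq> V\<close> crit in auto)
  then show False using assms(2) by simp
qed

end

section \<open>Critical graphs in terms of the adjacency relation\<close>

abbreviation adjacent :: "'a pair_pre_digraph \<Rightarrow> 'a \<Rightarrow> 'a \<Rightarrow> bool" where
  "adjacent G x y \<equiv> (x, y) \<in> parcs G"

definition embeds :: "'b pair_pre_digraph \<Rightarrow> 'a pair_pre_digraph \<Rightarrow> bool" where
  "embeds F G \<longleftrightarrow> (\<exists>f. inj_on f (pverts F) \<and> f ` pverts F \<subseteq> pverts G \<and>
     (\<forall>x\<in>pverts F. \<forall>y\<in>pverts F. adjacent G (f x) (f y) \<longleftrightarrow> adjacent F x y))"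

text \<open>An isomorphism from an induced subgraph onto \<open>F\<close> is inverted to get the
  embedding. Conversely, the subgraph induced on the image of an embedding is mapped onto
  \<open>F\<close> by the inverse.\<close>

lemma contains_induced_iff_embeds:
  assumes G: "pair_wf_digraph G" and F: "pair_wf_digraph F"
  shows "contains_induced (with_proj G) (with_proj F) \<longleftrightarrow> embeds F G"
proof
  assume "contains_induced (with_proj G) (with_proj F)"
  then obtain S hom where S: "induced_subgraph S (with_proj G)"
      and hom: "pre_digraph.digraph_isomorphism S hom" "with_proj F = app_iso hom S"
    unfolding contains_induced_def digraph_iso_def by blast
  have arcs: "arcs S = {e \<in> parcs G. fst e \<in> verts S \<and> snd e \<in> verts S}" "verts S \<subseteq> pverts G"
    and ends: "tail S = fst" "head S = snd"
    using S unfolding induced_subgraph_def subgraph_def compatible_def by auto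
  have F_eq: "pverts F = iso_verts hom ` verts S" "parcs F = iso_arcs hom ` arcs S"
      "iso_tail hom = fst" "iso_head hom = snd"
    using arg_cong[OF hom(2), of verts] arg_cong[OF hom(2), of arcs]
      arg_cong[OF hom(2), of tail] arg_cong[OF hom(2), of head] by auto
  have inj: "inj_on (iso_verts hom) (verts S)"
    using pre_digraph.digraph_isomorphism_inj_on_verts[OF hom(1)] .
  have iso_arcs: "iso_arcs hom a = (iso_verts hom (fst a), iso_verts hom (snd a))" if "a \<in> arcs S" for a
    using pre_digraph.iso_verts_tail[OF hom(1) that] pre_digraph.iso_verts_head[OF hom(1) that]
    unfolding F_eq ends by (simp add: prod_eq_iff)
  define f where "f = the_inv_into (verts S) (iso_verts hom)"
  have f: "f x \<in> verts S" "iso_verts hom (f x) = x" if "x \<in> pverts F" for x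
    using that inj unfolding f_def F_eq
    by (auto simp: the_inv_into_f_f)
  have "adjacent G (f x) (f y) \<longleftrightarrow> adjacent F x y" if xy: "x \<in> pverts F" "y \<in> pverts F" for x y
  proof
    assume "adjacent G (f x) (f y)"
    then have "(f x, f y) \<in> arcs S" using arcs f xy by simp
    then have "iso_arcs hom (f x, f y) \<in> parcs F" unfolding F_eq(2) by (rule imageI)
    then show "adjacent F x y"
      using iso_arcs[OF \<open>(f x, f y) \<in> arcs S\<close>] f(2) xy by simp
  next
    assume "adjacent F x y"
    then obtain a where a: "a \<in> arcs S" "iso_arcs hom a = (x, y)" unfolding F_eq(2) by force
    then have "iso_verts hom (fst a) = x" "iso_verts hom (snd a) = y" using iso_arcs by auto
    then have "f x = fst a" "f y = snd a"
      using a(1) arcs(1) inj unfolding f_def by (auto simp: the_inv_into_f_f)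
    then show "adjacent G (f x) (f y)" using a(1) arcs(1) by simp
  qed
  moreover have "inj_on f (pverts F)" by (rule inj_on_inverseI) (rule f(2))
  moreover have "f ` pverts F \<subseteq> pverts G" using f(1) arcs(2) by auto
  ultimately show "embeds F G" unfolding embeds_def by blast
next
  interpret G: pair_wf_digraph G by (fact G)
  interpret F: pair_wf_digraph F by (fact F)
  assume "embeds F G"
  then obtain f where inj: "inj_on f (pverts F)" and f: "f ` pverts F \<subseteq> pverts G"
      and adj: "\<And>x y. x \<in> pverts F \<Longrightarrow> y \<in> pverts F \<Longrightarrow> adjacent G (f x) (f y) \<longleftrightarrow> adjacent F x y"
    unfolding embeds_def by blast
  define S where "S = with_proj G \<restriction> (f ` pverts F)"
  define g where "g = the_inv_into (pverts F) f"
  have g: "g (f x) = x" if "x \<in> pverts F" for x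
    using that inj unfolding g_def by (rule the_inv_into_f_f[rotated])
  have S: "verts S = f ` pverts F" "arcs S = map_prod f f ` parcs F" "tail S = fst" "head S = snd"
  proof -
    have "arcs S = {e \<in> parcs G. fst e \<in> f ` pverts F \<and> snd e \<in> f ` pverts F}"
      unfolding S_def by (simp add: induce_subgraph_arcs)
    also have "\<dots> = map_prod f f ` parcs F"
    proof (intro equalityI subsetI)
      fix e assume "e \<in> {e \<in> parcs G. fst e \<in> f ` pverts F \<and> snd e \<in> f ` pverts F}"
      then obtain x y where xy: "x \<in> pverts F" "y \<in> pverts F" "e = (f x, f y)" "e \<in> parcs G"
        by (cases e) auto
      then have "adjacent F x y" using adj by blast
      then show "e \<in> map_prod f f ` parcs F" using xy(3) by (intro image_eqI[of _ _ "(x, y)"]) auto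
    next
      fix e assume "e \<in> map_prod f f ` parcs F"
      then obtain x y where xy: "adjacent F x y" "e = (f x, f y)" by auto
      then have "x \<in> pverts F" "y \<in> pverts F" using F.in_arcsD1 F.in_arcsD2 by blast+
      then show "e \<in> {e \<in> parcs G. fst e \<in> f ` pverts F \<and> snd e \<in> f ` pverts F}"
        using xy adj by simp
    qed
    finally show "arcs S = map_prod f f ` parcs F" .
  qed (auto simp: S_def)
  have sub: "induced_subgraph S (with_proj G)"
    unfolding S_def using f by (intro G.induced_induce) simp
  \<comment> \<open>Arcs are pairs of vertices, so the arc map is determined by \<open>g\<close> and
    the new tail and head are again the projections.\<close>
  define hom :: "('a, 'a \<times> 'a, 'b, 'b \<times> 'b) digraph_isomorphism"
    where "hom = \<lparr>iso_verts = g, iso_arcs = map_prod g g, iso_head = snd, iso_tail = fst\<rparr>"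
  have "pre_digraph.digraph_isomorphism S hom"
    unfolding pre_digraph.digraph_isomorphism_def
  proof (intro conjI)
    show "wf_digraph S" using sub
      unfolding induced_subgraph_def subgraph_def by blast
    have g_inj: "inj_on g (f ` pverts F)" using g by (intro inj_onI) auto
    then show "inj_on (iso_verts hom) (verts S)" by (simp add: S hom_def)
    have "arcs S \<subseteq> f ` pverts F \<times> f ` pverts F"
      using F.in_arcsD1 F.in_arcsD2 unfolding S by auto
    then show "inj_on (iso_arcs hom) (arcs S)"
      unfolding hom_def using inj_on_subset[OF map_prod_inj_on[OF g_inj g_inj]] by simp
  qed (auto simp: S hom_def)
  moreover have "app_iso hom S = with_proj F"
  proof -
    have "(map_prod g g \<circ> map_prod f f) ` parcs F = id ` parcs F"
      by (rule image_cong) (use F.in_arcsD1 F.in_arcsD2 g in auto)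
    moreover have "(g \<circ> f) ` pverts F = id ` pverts F"
      by (rule image_cong) (use g in auto)
    ultimately show ?thesis
      unfolding app_iso_def with_proj_def hom_def S by (simp add: image_comp)
  qed
  ultimately have "digraph_iso S (with_proj F)" unfolding digraph_iso_def by (metis (no_types))
  then show "contains_induced (with_proj G) (with_proj F)"
    unfolding contains_induced_def using sub by blast
qed

section \<open>The gem and the co-gem as concrete graphs\<close>

lemma verts_co_gem: "pverts co_gem = {Inl 0, Inl 1, Inl 2, Inl 3, Inr 0}"
  unfolding co_gem_def disjoint_union_def path_graph_def by (auto simp: Plus_def numeral_eq_Suc lessThan_Suc)

lemma adjacent_co_gem:
  "adjacent co_gem x y \<longleftrightarrow> (x, y) \<in> {(Inl 0, Inl 1), (Inl 1, Inl 2), (Inl 2, Inl 3),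
     (Inl 1, Inl 0), (Inl 2, Inl 1), (Inl 3, Inl 2)}"
proof -
  have "parcs (path_graph 4) = {(0, 1), (1, 2), (2, 3), (1, 0), (2, 1), (3, 2)}"
    unfolding path_graph_def by (auto simp: numeral_eq_Suc less_Suc_eq)
  moreover have "parcs (path_graph 1) = {}" unfolding path_graph_def by auto
  ultimately show ?thesis unfolding co_gem_def disjoint_union_def by auto
qed

lemma pair_wf_co_gem: "pair_wf_digraph co_gem"
  by unfold_locales (auto simp: adjacent_co_gem verts_co_gem)

lemma pair_wf_gem: "pair_wf_digraph gem"
  by unfold_locales (auto simp: gem_def complement_graph_def)

lemma gem_co_gem_free_iff:
  assumes "pair_wf_digraph G"
  shows "gem_co_gem_free (with_proj G) \<longleftrightarrow> \<not> embeds gem G \<and> \<not> embeds co_gem G"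
  unfolding gem_co_gem_free_def
  by (simp add: contains_induced_iff_embeds assms pair_wf_gem pair_wf_co_gem)

lemma simple_graph_of_pair_graph:
  assumes "pair_graph G"
  shows "simple_graph (pverts G) (adjacent G)"
proof -
  interpret pair_graph G by (fact assms)
  show ?thesis by unfold_locales (auto dest: arcs_symmetric no_loops')
qed

text \<open>A forbidden configuration is an embedding of \<open>co_gem\<close>: \<open>Inl 0\<close>
  to \<open>Inl 3\<close> carry the path and \<open>Inr 0\<close> the isolated vertex.\<close>

lemma co_gem_free_of_pair_graph:
  assumes "pair_graph G" "\<not> embeds co_gem G"
  shows "co_gem_free_graph (pverts G) (adjacent G)"
proof -
  interpret simple_graph "pverts G" "adjacent G" by (rule simple_graph_of_pair_graph[OF assms(1)])
  show ?thesis
  proof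
    fix a b c d e
    assume V: "a \<in> pverts G" "b \<in> pverts G" "c \<in> pverts G" "d \<in> pverts G" "e \<in> pverts G"
      and adj: "adjacent G a b" "adjacent G b c" "adjacent G c d"
      and non: "\<not> adjacent G a c" "\<not> adjacent G a d" "\<not> adjacent G b d"
        "\<not> adjacent G a e" "\<not> adjacent G b e" "\<not> adjacent G c e" "\<not> adjacent G d e"
    define f where "f = case_sum (\<lambda>i::nat. [a, b, c, d] ! i) (\<lambda>_::nat. e)"
    have f: "f (Inl 0) = a" "f (Inl 1) = b" "f (Inl 2) = c" "f (Inl 3) = d" "f (Inr 0) = e"
      unfolding f_def by (simp_all add: numeral_eq_Suc)
    have non': "\<not> adjacent G c a" "\<not> adjacent G d a" "\<not> adjacent G d b"
        "\<not> adjacent G e a" "\<not> adjacent G e b" "\<not> adjacent G e c" "\<not> adjacent G e d"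
      using non adj_sym by blast+
    have "a \<noteq> b" "a \<noteq> c" "a \<noteq> d" "a \<noteq> e" "b \<noteq> c" "b \<noteq> d" "b \<noteq> e" "c \<noteq> d" "c \<noteq> e" "d \<noteq> e"
      using adj non non' adj_irrefl by metis+
    then have "inj_on f (pverts co_gem)"
      unfolding verts_co_gem inj_on_def by (simp add: f del: One_nat_def)
    moreover have "f ` pverts co_gem \<subseteq> pverts G" using V unfolding verts_co_gem by (simp add: f del: One_nat_def)
    moreover have "\<forall>x\<in>pverts co_gem. \<forall>y\<in>pverts co_gem. adjacent G (f x) (f y) \<longleftrightarrow> adjacent co_gem x y"
      unfolding verts_co_gem adjacent_co_gem
      by (simp add: f adj non non' adj_irrefl adj[THEN adj_sym] del: One_nat_def)
    ultimately show False using assms(2) unfolding embeds_def by blast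
  qed
qed

text \<open>Arcs of a well-formed graph join vertices, so a condition on all arcs is one on adjacent
  pairs of vertices, and deleting a vertex amounts to shrinking the vertex set.\<close>

lemma vertex_critical_iff_chi:
  assumes "pair_wf_digraph G"
  shows "vertex_critical k (with_proj G) \<longleftrightarrow> chi (adjacent G) (pverts G) = k \<and>
    (\<forall>v\<in>pverts G. chi (adjacent G) (pverts G - {v}) < k)"
proof -
  interpret pair_wf_digraph G by (fact assms)
  have "(\<exists>c. proper_colouring (with_proj G) n c) \<longleftrightarrow> colourable (adjacent G) (pverts G) n" for n
    unfolding proper_colouring_def colourable_def
    using in_arcsD1 in_arcsD2 by (intro ex_cong1) fastforce
  moreover have "(\<exists>c. proper_colouring (pre_digraph.del_vert (with_proj G) v) n c) \<longleftrightarrow>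
      colourable (adjacent G) (pverts G - {v}) n" for n v
  proof -
    have "arcs_ends (pre_digraph.del_vert (with_proj G) v) = {(x, y). adjacent G x y \<and> x \<noteq> v \<and> y \<noteq> v}"
      unfolding arcs_ends_conv by (auto simp: pre_digraph.del_vert_def image_iff)
    moreover have "verts (pre_digraph.del_vert (with_proj G) v) = pverts G - {v}"
      by (simp add: pre_digraph.del_vert_def)
    ultimately show ?thesis
      unfolding proper_colouring_def colourable_def
      using in_arcsD1 in_arcsD2 by (intro ex_cong1) fastforce
  qed
  ultimately show ?thesis unfolding vertex_critical_def chromatic_number_def chi_def by simp
qed

lemma card_verts_le_of_vertex_critical:
  assumes "pair_graph G" "vertex_critical k (with_proj G)" "gem_co_gem_free (with_proj G)" "k \<ge> 1"
  shows "card (pverts G) \<le> k * (k + 2) ^ (2 * k + 2)"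
proof -
  interpret pair_graph G by (fact assms(1))
  interpret g: co_gem_free_graph "pverts G" "adjacent G"
    using assms(3) gem_co_gem_free_iff[OF pair_wf_digraph] co_gem_free_of_pair_graph[OF assms(1)] by blast
  have crit: "chi (adjacent G) (pverts G) = k" "\<forall>v\<in>pverts G. chi (adjacent G) (pverts G - {v}) < k"
    using assms(2) vertex_critical_iff_chi[OF pair_wf_digraph] by auto
  show ?thesis
  proof (rule g.card_le_of_critical)
    show "colourable (adjacent G) (pverts G) k" using g.colourable_chi[OF order_refl] unfolding crit(1) .
    show "\<not> colourable (adjacent G) (pverts G) (k - 1)"
    proof
      assume "colourable (adjacent G) (pverts G) (k - 1)"
      then have "chi (adjacent G) (pverts G) \<le> k - 1" unfolding chi_def by (rule Least_le)
      \<comment> \<open>\<open>k \<ge> 1\<close> makes the truncated k - 1 strictly smaller than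
        k.\<close>
      then show False using crit(1) assms(4) by simp
    qed
    show "colourable (adjacent G) (pverts G - {v}) (k - 1)" if "v \<in> pverts G" for v
      using colourable_mono[OF g.colourable_chi[of "pverts G - {v}"] _ order_refl, of "k - 1"] crit(2) that by fastforce
  qed
qed

section \<open>Transport to the natural numbers\<close>

text \<open>Relabelling along an injection moves a graph on an arbitrary type to natural-number
  vertices, where the representatives live.\<close>

definition image_graph :: "('a \<Rightarrow> 'b) \<Rightarrow> 'a pair_pre_digraph \<Rightarrow> 'b pair_pre_digraph" where
  "image_graph f G = \<lparr>pverts = f ` pverts G, parcs = map_prod f f ` parcs G\<rparr>"

lemma colourable_image:
  assumes "inj_on f W" "\<And>x y. x \<in> W \<Longrightarrow> y \<in> W \<Longrightarrow> adj' (f x) (f y) \<longleftrightarrow> adj x y"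
  shows "colourable adj' (f ` W) n \<longleftrightarrow> colourable adj W n"
proof
  assume "colourable adj' (f ` W) n"
  then obtain c where "c ` f ` W \<subseteq> {..<n}" "\<forall>u\<in>f ` W. \<forall>v\<in>f ` W. adj' u v \<longrightarrow> c u \<noteq> c v"
    unfolding colourable_def by blast
  then show "colourable adj W n" unfolding colourable_def
    using assms(2) by (intro exI[of _ "c \<circ> f"]) (auto simp: image_comp)
next
  assume "colourable adj W n"
  then obtain c where "c ` W \<subseteq> {..<n}" "\<forall>u\<in>W. \<forall>v\<in>W. adj u v \<longrightarrow> c u \<noteq> c v"
    unfolding colourable_def by blast
  then show "colourable adj' (f ` W) n" unfolding colourable_def
    using assms by (intro exI[of _ "c \<circ> the_inv_into W f"]) (auto simp: the_inv_into_f_f)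
qed

context
  fixes G :: "'a pair_pre_digraph" and f :: "'a \<Rightarrow> 'b"
  assumes G: "pair_graph G" and inj: "inj_on f (pverts G)"
begin

interpretation pair_graph G by (fact G)

lemma adjacent_image_graph:
  "x \<in> pverts G \<Longrightarrow> y \<in> pverts G \<Longrightarrow> adjacent (image_graph f G) (f x) (f y) \<longleftrightarrow> adjacent G x y"
proof
  assume x: "x \<in> pverts G" and y: "y \<in> pverts G"
    and "adjacent (image_graph f G) (f x) (f y)"
  then obtain a b where ab: "adjacent G a b" "f x = f a" "f y = f b" unfolding image_graph_def by auto
  then have "a \<in> pverts G" "b \<in> pverts G" using in_arcsD1 in_arcsD2 by blast+
  then show "adjacent G x y" using ab x y inj by (metis inj_onD)
qed (force simp: image_graph_def)

lemma pair_graph_image_graph: "pair_graph (image_graph f G)"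
proof
  show "symmetric (with_proj (image_graph f G))"
    unfolding symmetric_def using arcs_symmetric by (auto simp: image_graph_def sym_def)
  show "fst e \<noteq> snd e" if "e \<in> parcs (image_graph f G)" for e
  proof -
    obtain x y where "adjacent G x y" "e = (f x, f y)" using \<open>e \<in> _\<close> unfolding image_graph_def by auto
    moreover from this have "x \<in> pverts G" "y \<in> pverts G" "x \<noteq> y"
      using in_arcsD1 in_arcsD2 no_loops' by blast+
    ultimately show ?thesis using inj by (auto dest: inj_onD)
  qed
qed (use in_arcsD1 in_arcsD2 pair_finite_verts pair_finite_arcs in \<open>auto simp: image_graph_def\<close>)

lemma digraph_iso_image_graph: "digraph_iso (with_proj G) (with_proj (image_graph f G))"
proof -
  define hom where "hom = \<lparr>iso_verts = f, iso_arcs = map_prod f f, iso_head = snd, iso_tail = fst\<rparr>"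
  have "parcs G \<subseteq> pverts G \<times> pverts G" using in_arcsD1 in_arcsD2 by auto
  then have "inj_on (map_prod f f) (parcs G)" using inj_on_subset[OF map_prod_inj_on[OF inj inj]] by blast
  then have "pre_digraph.digraph_isomorphism (with_proj G) hom"
    unfolding pre_digraph.digraph_isomorphism_def using inj wf_digraph by (simp add: hom_def)
  moreover have "with_proj (image_graph f G) = app_iso hom (with_proj G)"
    unfolding app_iso_def with_proj_def image_graph_def hom_def by simp
  ultimately show ?thesis unfolding digraph_iso_def by blast
qed

lemma embeds_image_graph: "embeds F (image_graph f G) \<Longrightarrow> embeds F G"
proof -
  assume "embeds F (image_graph f G)"
  then obtain h where h: "inj_on h (pverts F)" "h ` pverts F \<subseteq> f ` pverts G"
      "\<And>x y. x \<in> pverts F \<Longrightarrow> y \<in> pverts F \<Longrightarrow> adjacent (image_graph f G) (h x) (h y) \<longleftrightarrow> adjacent F x y"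
    unfolding embeds_def by (auto simp: image_graph_def)
  define g where "g = the_inv_into (pverts G) f"
  have g: "g (h x) \<in> pverts G" "f (g (h x)) = h x" if "x \<in> pverts F" for x
  proof -
    have "h x \<in> f ` pverts G" using h(2) that by blast
    then show "g (h x) \<in> pverts G" "f (g (h x)) = h x"
      using the_inv_into_into[OF inj _ order_refl] f_the_inv_into_f[OF inj] unfolding g_def by auto
  qed
  have "inj_on (g \<circ> h) (pverts F)" using g(2) h(1) by (intro inj_onI) (metis comp_apply inj_onD)
  moreover have "adjacent G ((g \<circ> h) x) ((g \<circ> h) y) \<longleftrightarrow> adjacent F x y"
    if "x \<in> pverts F" "y \<in> pverts F" for x y
    using adjacent_image_graph[of "g (h x)" "g (h y)"] g h(3) that by simp
  ultimately show ?thesis unfolding embeds_def using g(1) by (intro exI[of _ "g \<circ> h"]) auto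
qed

lemma pair_wf_image_graph: "pair_wf_digraph (image_graph f G)"
  by (rule pair_digraph.pair_wf_digraph[OF pair_graph.axioms(1)[OF pair_graph_image_graph]])

lemma gem_co_gem_free_image_graph:
  assumes "gem_co_gem_free (with_proj G)"
  shows "gem_co_gem_free (with_proj (image_graph f G))"
  using assms embeds_image_graph[of gem] embeds_image_graph[of co_gem]
  unfolding gem_co_gem_free_iff[OF pair_wf_digraph] gem_co_gem_free_iff[OF pair_wf_image_graph]
  by argo

lemma vertex_critical_image_graph:
  "vertex_critical k (with_proj G) \<Longrightarrow> vertex_critical k (with_proj (image_graph f G))"
proof -
  \<comment> \<open>Stated for all subsets, this covers the whole graph and its vertex deletions at
    once.\<close>
  have chi: "chi (adjacent (image_graph f G)) (f ` W) = chi (adjacent G) W" if "W \<subseteq> pverts G" for W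
  proof -
    have "colourable (adjacent (image_graph f G)) (f ` W) n = colourable (adjacent G) W n" for n
      using that inj_on_subset[OF inj that] adjacent_image_graph by (intro colourable_image) auto
    then have "colourable (adjacent (image_graph f G)) (f ` W) = colourable (adjacent G) W" by blast
    then show ?thesis unfolding chi_def by simp
  qed
  have verts: "pverts (image_graph f G) = f ` pverts G" by (simp add: image_graph_def)
  have del: "f ` pverts G - {f v} = f ` (pverts G - {v})" if "v \<in> pverts G" for v
    using that inj by (auto dest: inj_onD)
  assume "vertex_critical k (with_proj G)"
  then show ?thesis
    unfolding vertex_critical_iff_chi[OF pair_wf_digraph] vertex_critical_iff_chi[OF pair_wf_image_graph]
      verts by (simp add: chi del)
qed

end

section \<open>Finitely many graphs of bounded order\<close>

theorem theorem5:
  fixes k :: nat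
  assumes "k \<ge> 1"
  shows "\<exists>R :: nat pair_pre_digraph set.
           finite R \<and>
           (\<forall>H \<in> R. pair_graph H \<and> vertex_critical k (with_proj H) \<and>
              gem_co_gem_free (with_proj H)) \<and>
           (\<forall>G :: 'a pair_pre_digraph.
              pair_graph G \<and> vertex_critical k (with_proj G) \<and> gem_co_gem_free (with_proj G) \<longrightarrow>
              (\<exists>H \<in> R. digraph_iso (with_proj G) (with_proj H)))"
proof -
  define N where "N = k * (k + 2) ^ (2 * k + 2)"
  \<comment> \<open>All suitable graphs with labels below \<open>N\<close> are collected; isomorphic
    copies in \<open>R\<close> do no harm to finiteness.\<close>
  define R where "R = {H :: nat pair_pre_digraph. pverts H \<subseteq> {..<N} \<and> pair_graph H \<and>
    vertex_critical k (with_proj H) \<and> gem_co_gem_free (with_proj H)}"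
  have "finite R"
  proof (rule finite_subset)
    show "R \<subseteq> (\<lambda>(V, E). \<lparr>pverts = V, parcs = E\<rparr>) ` (Pow {..<N} \<times> Pow ({..<N} \<times> {..<N}))"
    proof
      fix H assume H: "H \<in> R"
      then interpret pair_graph H by (simp add: R_def)
      have "pverts H \<subseteq> {..<N}" using H by (simp add: R_def)
      moreover have "parcs H \<subseteq> pverts H \<times> pverts H" using in_arcsD1 in_arcsD2 by auto
      ultimately have "parcs H \<subseteq> {..<N} \<times> {..<N}" by blast
      then show "H \<in> (\<lambda>(V, E). \<lparr>pverts = V, parcs = E\<rparr>) ` (Pow {..<N} \<times> Pow ({..<N} \<times> {..<N}))"
        using H unfolding R_def by (intro image_eqI[of _ _ "(pverts H, parcs H)"]) auto
    qed
  qed simp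
  moreover have "\<exists>H \<in> R. digraph_iso (with_proj G) (with_proj H)"
    if G: "pair_graph G" "vertex_critical k (with_proj G)" "gem_co_gem_free (with_proj G)"
    for G :: "'a pair_pre_digraph"
  proof -
    interpret pair_graph G by (fact G)
    obtain f where f: "bij_betw f (pverts G) {0..<card (pverts G)}"
      using ex_bij_betw_finite_nat[OF pair_finite_verts] by blast
    then have inj: "inj_on f (pverts G)" by (rule bij_betw_imp_inj_on)
    have "pverts (image_graph f G) \<subseteq> {..<N}"
      using f card_verts_le_of_vertex_critical[OF G assms] unfolding bij_betw_def image_graph_def N_def by auto
    then have "image_graph f G \<in> R"
      unfolding R_def using pair_graph_image_graph[OF G(1) inj] G(2,3)
        vertex_critical_image_graph[OF G(1) inj] gem_co_gem_free_image_graph[OF G(1) inj] by blast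
    then show ?thesis using digraph_iso_image_graph[OF G(1) inj] by blast
  qed
  ultimately show ?thesis unfolding R_def by (intro exI[of _ R]) (auto simp: R_def)
qed

end
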